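(* Let $T>0$, $c>0$, and let $x,\lambda:[0,T]\times[0,\infty)\to\mathbb{R}^n$ and $u:[0,T]\times[0,\infty)\to\mathbb{R}^m$ be fields of $(t,\tau)$. Let $\Theta$ take values in $GL(n,\mathbb{R})$ and assume that $\Theta$ is independent of $t$. Let $p=\Theta\,\partial_t x$, $q=\Theta^{-\top}\lambda$, let $r_x,r_\lambda$ be the residuals, $w_\pm$ the wave variables and $E_\pm$ the wave residuals defined in the context. If $(p,q)$ satisfy, on $[0,T]\times[0,\infty)$, $$\partial_\tau p + c\,\partial_t q = -c\,\Theta\, r_x,\qquad \partial_\tau q + c\,\partial_t p = -c\,\Theta^{-\top} r_\lambda,$$ then the wave variables satisfy, on $[0,T]\times[0,\infty)$, $$\partial_\tau w_+ + c\,\partial_t w_+ = -c\,E_+,\qquad \partial_\tau w_- - c\,\partial_t w_- = -c\,E_-.$$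
   Context: Optimal control setting: $f:\mathbb{R}^n\times\mathbb{R}^m\to\mathbb{R}^n$ is the dynamics and $L:\mathbb{R}^n\times\mathbb{R}^m\to\mathbb{R}$ the running cost, both continuously differentiable. The Hamiltonian is $H(x,\lambda,u)=L(x,u)+\lambda^\top f(x,u)$, so $\nabla_\lambda H=f(x,u)$. The variable $t\in[0,T]$ is physical time, $\tau\in[0,\infty)$ is an auxiliary optimization time, and $c>0$ is the propagation speed. The state $x$, costate $\lambda$ and control $u$ are functions of $(t,\tau)$. Residuals (with the gradients of $H$ evaluated at $(x(t,\tau),\lambda(t,\tau),u(t,\tau))$): $$r_x(t,\tau)=\partial_t x(t,\tau)-\nabla_\lambda H,\qquad r_\lambda(t,\tau)=\partial_t\lambda(t,\tau)+\nabla_x H.$$ For invertible $\Theta$, with $\Theta^{-\top}=(\Theta^{-1})^\top$, the wave variables and wave residuals are $$p=\Theta\,\partial_t x,\quad q=\Theta^{-\top}\lambda,\quad w_\pm=\tfrac{1}{\sqrt2}(p\pm q),\qquad E_\pm=\tfrac{1}{\sqrt2}\bigl(\Theta r_x\pm\Theta^{-\top}r_\lambda\bigr).$$ Regularity: $x$ and $\lambda$ are differentiable in $t$, and $p,q$ are differentiable in $t$ and $\tau$, so that all displayed derivatives exist in the classical sense. *)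

theory Defs
  imports "HOL-Analysis.Analysis"
begin

definition C1_map :: "('a::real_normed_vector \<Rightarrow> 'b::real_normed_vector) \<Rightarrow> bool" where
  "C1_map g \<longleftrightarrow>
     (\<exists>g' :: 'a \<Rightarrow> ('a \<Rightarrow>\<^sub>L 'b). (\<forall>z. (g has_derivative blinfun_apply (g' z)) (at z)) \<and>
        continuous_on UNIV g')"

definition gradient :: "('a::real_inner \<Rightarrow> real) \<Rightarrow> 'a \<Rightarrow> 'a" where
  "gradient g z = (THE D. GDERIV g z :> D)"

lemma gradient_eqI:
  fixes g :: "'a::real_inner \<Rightarrow> real"
  assumes "GDERIV g z :> D"
  shows "gradient g z = D"
  unfolding gradient_def
proof (rule the_equality[where P = "\<lambda>D. GDERIV g z :> D", OF assms])
  fix D' assume "GDERIV g z :> D'"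
  then have "(\<lambda>h. inner h D') = (\<lambda>h. inner h D)"
    using assms has_derivative_unique unfolding gderiv_def by blast
  then show "D' = D"
    by (metis vector_eq_rdot inner_commute)
qed

(* Fields are functions of physical time t in {0..T} and optimization time \<tau> in {0..}; values
   outside this region play no role.  At t = 0, t = T and \<tau> = 0 the partial derivatives are
   one-sided.  The value of a partial derivative is meaningful only together with the
   corresponding differentiability predicate. *)

definition dt_exists ::
    "real \<Rightarrow> (real \<Rightarrow> real \<Rightarrow> 'a::real_normed_vector) \<Rightarrow> real \<Rightarrow> real \<Rightarrow> bool" where
  "dt_exists T g t \<tau> \<longleftrightarrow> (\<lambda>s. g s \<tau>) differentiable (at t within {0..T})"

definition dt :: "real \<Rightarrow> (real \<Rightarrow> real \<Rightarrow> 'a::real_normed_vector) \<Rightarrow> real \<Rightarrow> real \<Rightarrow> 'a" where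
  "dt T g t \<tau> = vector_derivative (\<lambda>s. g s \<tau>) (at t within {0..T})"

definition dtau_exists ::
    "(real \<Rightarrow> real \<Rightarrow> 'a::real_normed_vector) \<Rightarrow> real \<Rightarrow> real \<Rightarrow> bool" where
  "dtau_exists g t \<tau> \<longleftrightarrow> (\<lambda>s. g t s) differentiable (at \<tau> within {0..})"

definition dtau :: "(real \<Rightarrow> real \<Rightarrow> 'a::real_normed_vector) \<Rightarrow> real \<Rightarrow> real \<Rightarrow> 'a" where
  "dtau g t \<tau> = vector_derivative (\<lambda>s. g t s) (at \<tau> within {0..})"

definition hamiltonian ::
    "((real^'n) \<times> (real^'m) \<Rightarrow> real^'n) \<Rightarrow> ((real^'n) \<times> (real^'m) \<Rightarrow> real) \<Rightarrow>
     real^'n \<Rightarrow> real^'n \<Rightarrow> real^'m \<Rightarrow> real" where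
  "hamiltonian f L x l u = L (x, u) + l \<bullet> f (x, u)"

definition grad_x_H ::
    "((real^'n) \<times> (real^'m) \<Rightarrow> real^'n) \<Rightarrow> ((real^'n) \<times> (real^'m) \<Rightarrow> real) \<Rightarrow>
     real^'n \<Rightarrow> real^'n \<Rightarrow> real^'m \<Rightarrow> real^'n" where
  "grad_x_H f L x l u = gradient (\<lambda>y. hamiltonian f L y l u) x"

definition grad_lambda_H ::
    "((real^'n) \<times> (real^'m) \<Rightarrow> real^'n) \<Rightarrow> ((real^'n) \<times> (real^'m) \<Rightarrow> real) \<Rightarrow>
     real^'n \<Rightarrow> real^'n \<Rightarrow> real^'m \<Rightarrow> real^'n" where
  "grad_lambda_H f L x l u = gradient (\<lambda>k. hamiltonian f L x k u) l"

lemma grad_lambda_H_eq: "grad_lambda_H f L x l u = f (x, u)"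
  unfolding grad_lambda_H_def hamiltonian_def
  by (rule gradient_eqI) (auto simp: gderiv_def intro!: derivative_eq_intros)

definition res_x ::
    "real \<Rightarrow> ((real^'n) \<times> (real^'m) \<Rightarrow> real^'n) \<Rightarrow> ((real^'n) \<times> (real^'m) \<Rightarrow> real) \<Rightarrow>
     (real \<Rightarrow> real \<Rightarrow> real^'n) \<Rightarrow> (real \<Rightarrow> real \<Rightarrow> real^'n) \<Rightarrow> (real \<Rightarrow> real \<Rightarrow> real^'m) \<Rightarrow>
     real \<Rightarrow> real \<Rightarrow> real^'n" where
  "res_x T f L x l u t \<tau> = dt T x t \<tau> - grad_lambda_H f L (x t \<tau>) (l t \<tau>) (u t \<tau>)"

definition res_lambda ::
    "real \<Rightarrow> ((real^'n) \<times> (real^'m) \<Rightarrow> real^'n) \<Rightarrow> ((real^'n) \<times> (real^'m) \<Rightarrow> real) \<Rightarrow>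
     (real \<Rightarrow> real \<Rightarrow> real^'n) \<Rightarrow> (real \<Rightarrow> real \<Rightarrow> real^'n) \<Rightarrow> (real \<Rightarrow> real \<Rightarrow> real^'m) \<Rightarrow>
     real \<Rightarrow> real \<Rightarrow> real^'n" where
  "res_lambda T f L x l u t \<tau> = dt T l t \<tau> + grad_x_H f L (x t \<tau>) (l t \<tau>) (u t \<tau>)"

definition inv_transpose :: "real^'n^'n \<Rightarrow> real^'n^'n" where
  "inv_transpose A = transpose (matrix_inv A)"

definition wave_p ::
    "real \<Rightarrow> (real \<Rightarrow> real \<Rightarrow> real^'n^'n) \<Rightarrow> (real \<Rightarrow> real \<Rightarrow> real^'n) \<Rightarrow>
     real \<Rightarrow> real \<Rightarrow> real^'n" where
  "wave_p T \<Theta> x t \<tau> = \<Theta> t \<tau> *v dt T x t \<tau>"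

definition wave_q ::
    "(real \<Rightarrow> real \<Rightarrow> real^'n^'n) \<Rightarrow> (real \<Rightarrow> real \<Rightarrow> real^'n) \<Rightarrow> real \<Rightarrow> real \<Rightarrow> real^'n" where
  "wave_q \<Theta> l t \<tau> = inv_transpose (\<Theta> t \<tau>) *v l t \<tau>"

definition w_plus ::
    "real \<Rightarrow> (real \<Rightarrow> real \<Rightarrow> real^'n^'n) \<Rightarrow> (real \<Rightarrow> real \<Rightarrow> real^'n) \<Rightarrow>
     (real \<Rightarrow> real \<Rightarrow> real^'n) \<Rightarrow> real \<Rightarrow> real \<Rightarrow> real^'n" where
  "w_plus T \<Theta> x l t \<tau> = (1 / sqrt 2) *\<^sub>R (wave_p T \<Theta> x t \<tau> + wave_q \<Theta> l t \<tau>)"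

definition w_minus ::
    "real \<Rightarrow> (real \<Rightarrow> real \<Rightarrow> real^'n^'n) \<Rightarrow> (real \<Rightarrow> real \<Rightarrow> real^'n) \<Rightarrow>
     (real \<Rightarrow> real \<Rightarrow> real^'n) \<Rightarrow> real \<Rightarrow> real \<Rightarrow> real^'n" where
  "w_minus T \<Theta> x l t \<tau> = (1 / sqrt 2) *\<^sub>R (wave_p T \<Theta> x t \<tau> - wave_q \<Theta> l t \<tau>)"

definition E_plus ::
    "real \<Rightarrow> ((real^'n) \<times> (real^'m) \<Rightarrow> real^'n) \<Rightarrow> ((real^'n) \<times> (real^'m) \<Rightarrow> real) \<Rightarrow>
     (real \<Rightarrow> real \<Rightarrow> real^'n^'n) \<Rightarrow>
     (real \<Rightarrow> real \<Rightarrow> real^'n) \<Rightarrow> (real \<Rightarrow> real \<Rightarrow> real^'n) \<Rightarrow> (real \<Rightarrow> real \<Rightarrow> real^'m) \<Rightarrow>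
     real \<Rightarrow> real \<Rightarrow> real^'n" where
  "E_plus T f L \<Theta> x l u t \<tau> = (1 / sqrt 2) *\<^sub>R
     (\<Theta> t \<tau> *v res_x T f L x l u t \<tau> + inv_transpose (\<Theta> t \<tau>) *v res_lambda T f L x l u t \<tau>)"

definition E_minus ::
    "real \<Rightarrow> ((real^'n) \<times> (real^'m) \<Rightarrow> real^'n) \<Rightarrow> ((real^'n) \<times> (real^'m) \<Rightarrow> real) \<Rightarrow>
     (real \<Rightarrow> real \<Rightarrow> real^'n^'n) \<Rightarrow>
     (real \<Rightarrow> real \<Rightarrow> real^'n) \<Rightarrow> (real \<Rightarrow> real \<Rightarrow> real^'n) \<Rightarrow> (real \<Rightarrow> real \<Rightarrow> real^'m) \<Rightarrow>
     real \<Rightarrow> real \<Rightarrow> real^'n" where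
  "E_minus T f L \<Theta> x l u t \<tau> = (1 / sqrt 2) *\<^sub>R
     (\<Theta> t \<tau> *v res_x T f L x l u t \<tau> - inv_transpose (\<Theta> t \<tau>) *v res_lambda T f L x l u t \<tau>)"

end

theory Submission
  imports Defs
begin

text \<open>
  The two evolution equations couple \<open>p\<close> and \<open>q\<close> only through the exchange matrix with rows
  \<open>(0, 1)\<close> and \<open>(1, 0)\<close>, whose eigenvectors are \<open>(1, \<sigma>)\<close> with eigenvalue \<open>\<sigma> = 1\<close> or \<open>\<sigma> = - 1\<close>.
  Adding \<open>\<sigma>\<close> times the second equation to the first therefore produces a transport equation for
  \<open>p + \<sigma> q\<close> with velocity \<open>\<sigma> c\<close>; the only property of \<open>\<sigma>\<close> that matters is \<open>\<sigma> * \<sigma> = 1\<close>.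
  This computation is \<open>characteristic_combination\<close>.  It rests on linearity of the (possibly
  one-sided) partial derivatives, which needs differentiability of the two fields and the fact
  that the domain of differentiation accumulates at the base point, so that derivatives are
  unique there.
\<close>

lemma at_within_nontrivial_if_connected:
  fixes a :: "'a::metric_space"
  assumes "connected S" "a \<in> S" "b \<in> S" "a \<noteq> b"
  shows "at a within S \<noteq> bot"
  using connected_imp_perfect[of S a] assms by (auto simp: trivial_limit_within)

lemma has_vector_derivative_scaled_combination:
  fixes g h :: "real \<Rightarrow> 'a::real_normed_vector"
  assumes "g differentiable (at a within S)" "h differentiable (at a within S)"
  shows "((\<lambda>s. k *\<^sub>R (g s + \<sigma> *\<^sub>R h s)) has_vector_derivative
           k *\<^sub>R (vector_derivative g (at a within S) + \<sigma> *\<^sub>R vector_derivative h (at a within S)))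
         (at a within S)"
proof -
  have "(g has_vector_derivative vector_derivative g (at a within S)) (at a within S)"
    and "(h has_vector_derivative vector_derivative h (at a within S)) (at a within S)"
    using assms by (simp_all add: vector_derivative_works)
  then show ?thesis
    by (auto intro!: derivative_eq_intros)
qed

lemma vector_derivative_scaled_combination:
  fixes g h :: "real \<Rightarrow> 'a::real_normed_vector"
  assumes "g differentiable (at a within S)" "h differentiable (at a within S)"
    and "at a within S \<noteq> bot"
  shows "vector_derivative (\<lambda>s. k *\<^sub>R (g s + \<sigma> *\<^sub>R h s)) (at a within S)
         = k *\<^sub>R (vector_derivative g (at a within S) + \<sigma> *\<^sub>R vector_derivative h (at a within S))"
  by (rule vector_derivative_within[OF assms(3)
        has_vector_derivative_scaled_combination[OF assms(1,2)]])

text \<open>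
  Both transport equations at once: \<open>\<sigma> = 1\<close> is the right-moving combination and \<open>\<sigma> = - 1\<close> the
  left-moving one.  The right-hand sides \<open>P\<close> and \<open>Q\<close> of the coupled system are arbitrary.
\<close>

lemma characteristic_combination:
  fixes p q :: "real \<Rightarrow> real \<Rightarrow> 'a::real_normed_vector"
    and T c k \<sigma> t \<tau> :: real
  assumes T: "T > 0" and t: "t \<in> {0..T}" and \<tau>: "\<tau> \<ge> 0" and \<sigma>: "\<sigma> * \<sigma> = 1"
    and p: "dt_exists T p t \<tau>" "dtau_exists p t \<tau>"
    and q: "dt_exists T q t \<tau>" "dtau_exists q t \<tau>"
    and p_eq: "dtau p t \<tau> + c *\<^sub>R dt T q t \<tau> = - c *\<^sub>R P"
    and q_eq: "dtau q t \<tau> + c *\<^sub>R dt T p t \<tau> = - c *\<^sub>R Q"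
  defines "w \<equiv> \<lambda>t \<tau>. k *\<^sub>R (p t \<tau> + \<sigma> *\<^sub>R q t \<tau>)"
  shows "dt_exists T w t \<tau>" and "dtau_exists w t \<tau>"
    and "dtau w t \<tau> + (\<sigma> * c) *\<^sub>R dt T w t \<tau> = - c *\<^sub>R (k *\<^sub>R (P + \<sigma> *\<^sub>R Q))"
proof -
  note diff = p[unfolded dt_exists_def dtau_exists_def] q[unfolded dt_exists_def dtau_exists_def]
  show "dt_exists T w t \<tau>" "dtau_exists w t \<tau>"
    unfolding dt_exists_def dtau_exists_def w_def
    using diff by (auto intro!: differentiableI_vector has_vector_derivative_scaled_combination)
  have "at t within {0..T} \<noteq> bot"
    using T t at_within_nontrivial_if_connected[of "{0..T}" t "if t = 0 then T else 0"]
    by auto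
  then have dt_w: "dt T w t \<tau> = k *\<^sub>R (dt T p t \<tau> + \<sigma> *\<^sub>R dt T q t \<tau>)"
    unfolding dt_def w_def by (intro vector_derivative_scaled_combination diff)
  have "at \<tau> within {0..} \<noteq> bot"
    using \<tau> at_within_nontrivial_if_connected[of "{0..}" \<tau> "\<tau> + 1"] by simp
  then have dtau_w: "dtau w t \<tau> = k *\<^sub>R (dtau p t \<tau> + \<sigma> *\<^sub>R dtau q t \<tau>)"
    unfolding dtau_def w_def by (intro vector_derivative_scaled_combination diff)
  have "dtau w t \<tau> + (\<sigma> * c) *\<^sub>R dt T w t \<tau>
      = k *\<^sub>R (dtau p t \<tau> + ((\<sigma> * \<sigma>) * c) *\<^sub>R dt T q t \<tau>
          + \<sigma> *\<^sub>R (dtau q t \<tau> + c *\<^sub>R dt T p t \<tau>))"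
    unfolding dt_w dtau_w by (simp add: algebra_simps)
  also have "\<dots> = k *\<^sub>R (- c *\<^sub>R P + \<sigma> *\<^sub>R (- c *\<^sub>R Q))"
    using p_eq q_eq \<sigma> by simp
  also have "\<dots> = - c *\<^sub>R (k *\<^sub>R (P + \<sigma> *\<^sub>R Q))"
    by (simp add: algebra_simps)
  finally show "dtau w t \<tau> + (\<sigma> * c) *\<^sub>R dt T w t \<tau> = - c *\<^sub>R (k *\<^sub>R (P + \<sigma> *\<^sub>R Q))" .
qed

theorem proposition2p4:
  fixes T c :: real
    and f :: "(real^'n) \<times> (real^'m) \<Rightarrow> real^'n"
    and L :: "(real^'n) \<times> (real^'m) \<Rightarrow> real"
    and x l :: "real \<Rightarrow> real \<Rightarrow> real^'n"
    and u :: "real \<Rightarrow> real \<Rightarrow> real^'m"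
    and \<Theta> :: "real \<Rightarrow> real \<Rightarrow> real^'n^'n"
  assumes T_pos: "T > 0" and c_pos: "c > 0"
    and f_C1: "C1_map f" and L_C1: "C1_map L"
    and Theta_GL: "\<And>t \<tau>. t \<in> {0..T} \<Longrightarrow> \<tau> \<ge> 0 \<Longrightarrow> invertible (\<Theta> t \<tau>)"
    and Theta_indep_t:
      "\<And>s t \<tau>. s \<in> {0..T} \<Longrightarrow> t \<in> {0..T} \<Longrightarrow> \<tau> \<ge> 0 \<Longrightarrow> \<Theta> s \<tau> = \<Theta> t \<tau>"
    and x_dt: "\<And>t \<tau>. t \<in> {0..T} \<Longrightarrow> \<tau> \<ge> 0 \<Longrightarrow> dt_exists T x t \<tau>"
    and l_dt: "\<And>t \<tau>. t \<in> {0..T} \<Longrightarrow> \<tau> \<ge> 0 \<Longrightarrow> dt_exists T l t \<tau>"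
    and p_dt: "\<And>t \<tau>. t \<in> {0..T} \<Longrightarrow> \<tau> \<ge> 0 \<Longrightarrow> dt_exists T (wave_p T \<Theta> x) t \<tau>"
    and p_dtau: "\<And>t \<tau>. t \<in> {0..T} \<Longrightarrow> \<tau> \<ge> 0 \<Longrightarrow> dtau_exists (wave_p T \<Theta> x) t \<tau>"
    and q_dt: "\<And>t \<tau>. t \<in> {0..T} \<Longrightarrow> \<tau> \<ge> 0 \<Longrightarrow> dt_exists T (wave_q \<Theta> l) t \<tau>"
    and q_dtau: "\<And>t \<tau>. t \<in> {0..T} \<Longrightarrow> \<tau> \<ge> 0 \<Longrightarrow> dtau_exists (wave_q \<Theta> l) t \<tau>"
    and p_eq: "\<And>t \<tau>. t \<in> {0..T} \<Longrightarrow> \<tau> \<ge> 0 \<Longrightarrow>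
      dtau (wave_p T \<Theta> x) t \<tau> + c *\<^sub>R dt T (wave_q \<Theta> l) t \<tau>
        = - c *\<^sub>R (\<Theta> t \<tau> *v res_x T f L x l u t \<tau>)"
    and q_eq: "\<And>t \<tau>. t \<in> {0..T} \<Longrightarrow> \<tau> \<ge> 0 \<Longrightarrow>
      dtau (wave_q \<Theta> l) t \<tau> + c *\<^sub>R dt T (wave_p T \<Theta> x) t \<tau>
        = - c *\<^sub>R (inv_transpose (\<Theta> t \<tau>) *v res_lambda T f L x l u t \<tau>)"
  shows "\<forall>t\<in>{0..T}. \<forall>\<tau>\<ge>0.
      dt_exists T (w_plus T \<Theta> x l) t \<tau> \<and> dtau_exists (w_plus T \<Theta> x l) t \<tau> \<and>
      dt_exists T (w_minus T \<Theta> x l) t \<tau> \<and> dtau_exists (w_minus T \<Theta> x l) t \<tau> \<and>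
      dtau (w_plus T \<Theta> x l) t \<tau> + c *\<^sub>R dt T (w_plus T \<Theta> x l) t \<tau>
        = - c *\<^sub>R E_plus T f L \<Theta> x l u t \<tau> \<and>
      dtau (w_minus T \<Theta> x l) t \<tau> - c *\<^sub>R dt T (w_minus T \<Theta> x l) t \<tau>
        = - c *\<^sub>R E_minus T f L \<Theta> x l u t \<tau>"
proof (intro ballI allI impI)
  fix t \<tau> :: real
  assume t: "t \<in> {0..T}" and \<tau>: "\<tau> \<ge> 0"
  have plus: "w_plus T \<Theta> x l
      = (\<lambda>t \<tau>. (1 / sqrt 2) *\<^sub>R (wave_p T \<Theta> x t \<tau> + 1 *\<^sub>R wave_q \<Theta> l t \<tau>))"
    by (simp add: fun_eq_iff w_plus_def)
  have minus: "w_minus T \<Theta> x l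
      = (\<lambda>t \<tau>. (1 / sqrt 2) *\<^sub>R (wave_p T \<Theta> x t \<tau> + (- 1) *\<^sub>R wave_q \<Theta> l t \<tau>))"
    by (simp add: fun_eq_iff w_minus_def)
  note combine = characteristic_combination[OF T_pos t \<tau> _ p_dt[OF t \<tau>] p_dtau[OF t \<tau>]
      q_dt[OF t \<tau>] q_dtau[OF t \<tau>] p_eq[OF t \<tau>] q_eq[OF t \<tau>], where k = "1 / sqrt 2"]
  note combine_plus = combine[where \<sigma> = 1, folded plus]
  note combine_minus = combine[where \<sigma> = "- 1", folded minus]
  show "dt_exists T (w_plus T \<Theta> x l) t \<tau> \<and> dtau_exists (w_plus T \<Theta> x l) t \<tau> \<and>
      dt_exists T (w_minus T \<Theta> x l) t \<tau> \<and> dtau_exists (w_minus T \<Theta> x l) t \<tau> \<and>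
      dtau (w_plus T \<Theta> x l) t \<tau> + c *\<^sub>R dt T (w_plus T \<Theta> x l) t \<tau>
        = - c *\<^sub>R E_plus T f L \<Theta> x l u t \<tau> \<and>
      dtau (w_minus T \<Theta> x l) t \<tau> - c *\<^sub>R dt T (w_minus T \<Theta> x l) t \<tau>
        = - c *\<^sub>R E_minus T f L \<Theta> x l u t \<tau>"
    using combine_plus combine_minus by (simp add: E_plus_def E_minus_def)
qed

end
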